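(* Let $G=(I,(S_i)_{i\in I},(g_i)_{i\in I})$ be a mixed strategy game with $|I|<\infty$, and suppose that each $S_i$ is a finite set. Then for any initial joint mixed strategy $\sigma\in\prod_{i\in I}\Delta S_i$ there exists a finite-length satisficing path $(\sigma^t)_{t=0}^{T}$ such that $\sigma^0=\sigma$ and $\sigma^T$ is a mixed equilibrium of $G$.
   Context: A mixed strategy game is a tuple $G=(I,(S_i)_{i\in I},(g_i)_{i\in I})$ with $I$ a finite set of players, $S_i$ the pure strategy set of player $i$, and $g_i:\prod_{j\in I}S_j\to\mathbb{R}$ the payoff function of player $i$; each player $i$ chooses a mixed strategy in $\Delta S_i$, the set of probability measures on $S_i$. For a joint mixed strategy $\sigma=(\sigma_i)_{i\in I}\in\prod_{i\in I}\Delta S_i$, the (expected) payoff of player $i$ is $$\tilde g_i(\sigma)=\sum_{s\in\prod_{j\in I}S_j}g_i(s)\prod_{j\in I}\sigma_j(s_j).$$ Write $\sigma_{-i}=(\sigma_j)_{j\ne i}$. Player $i$ achieves best response in $\sigma$ if $\tilde g_i(\sigma_i,\sigma_{-i})\ge\sup_{\tau\in\Delta S_i}\tilde g_i(\tau,\sigma_{-i})$. A joint mixed strategy $\sigma$ is a mixed equilibrium if every player achieves best response in $\sigma$. A satisficing path $(\sigma^t)_{t=0}^T$ is a sequence of joint mixed strategies such that for every $0\le t<T$ and every $i\in I$: if player $i$ achieves best response in $\sigma^t$, then $\sigma_i^{t+1}=\sigma_i^t$. *)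

theory Defs
  imports "HOL-Probability.Probability" "HOL-Library.FuncSet"
begin

text \<open>
  A game is given by a player set \<open>I\<close>, strategy sets \<open>S i\<close> inside a common type \<open>'s\<close>, and payoff
  functions \<open>g i\<close>. Elements of a product over \<open>I\<close> are extensional functions (\<open>PiE\<close>), so the values
  of \<open>g i\<close> outside \<open>PiE I S\<close> and of \<open>g i\<close>, \<open>S i\<close> for \<open>i \<notin> I\<close> are irrelevant. The definitions are meant
  for finite \<open>I\<close> and finite \<open>S i\<close>: the sum and the real-valued supremum below are junk values
  when the product is infinite or the payoffs are unbounded.
\<close>

definition mixed_strategies :: "'s set \<Rightarrow> 's pmf set" where
  "mixed_strategies A = {p. set_pmf p \<subseteq> A}"

definition joint_mixed_strategies :: "'i set \<Rightarrow> ('i \<Rightarrow> 's set) \<Rightarrow> ('i \<Rightarrow> 's pmf) set" where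
  "joint_mixed_strategies I S = (\<Pi>\<^sub>E i\<in>I. mixed_strategies (S i))"

definition expected_payoff ::
    "'i set \<Rightarrow> ('i \<Rightarrow> 's set) \<Rightarrow> ('i \<Rightarrow> ('i \<Rightarrow> 's) \<Rightarrow> real) \<Rightarrow> 'i \<Rightarrow> ('i \<Rightarrow> 's pmf) \<Rightarrow> real" where
  "expected_payoff I S g i \<sigma> = (\<Sum>s\<in>(\<Pi>\<^sub>E j\<in>I. S j). g i s * (\<Prod>j\<in>I. pmf (\<sigma> j) (s j)))"

definition achieves_best_response ::
    "'i set \<Rightarrow> ('i \<Rightarrow> 's set) \<Rightarrow> ('i \<Rightarrow> ('i \<Rightarrow> 's) \<Rightarrow> real) \<Rightarrow> 'i \<Rightarrow> ('i \<Rightarrow> 's pmf) \<Rightarrow> bool" where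
  "achieves_best_response I S g i \<sigma> \<longleftrightarrow>
     expected_payoff I S g i \<sigma> \<ge> (SUP \<tau>\<in>mixed_strategies (S i). expected_payoff I S g i (\<sigma>(i := \<tau>)))"

definition mixed_equilibrium ::
    "'i set \<Rightarrow> ('i \<Rightarrow> 's set) \<Rightarrow> ('i \<Rightarrow> ('i \<Rightarrow> 's) \<Rightarrow> real) \<Rightarrow> ('i \<Rightarrow> 's pmf) \<Rightarrow> bool" where
  "mixed_equilibrium I S g \<sigma> \<longleftrightarrow>
     \<sigma> \<in> joint_mixed_strategies I S \<and> (\<forall>i\<in>I. achieves_best_response I S g i \<sigma>)"

text \<open>Only the values \<open>p 0, \<dots>, p T\<close> of the sequence \<open>p\<close> matter.\<close>

definition satisficing_path ::
    "'i set \<Rightarrow> ('i \<Rightarrow> 's set) \<Rightarrow> ('i \<Rightarrow> ('i \<Rightarrow> 's) \<Rightarrow> real) \<Rightarrow> nat \<Rightarrow> (nat \<Rightarrow> 'i \<Rightarrow> 's pmf) \<Rightarrow> bool" where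
  "satisficing_path I S g T p \<longleftrightarrow>
     (\<forall>t\<le>T. p t \<in> joint_mixed_strategies I S) \<and>
     (\<forall>t<T. \<forall>i\<in>I. achieves_best_response I S g i (p t) \<longrightarrow> p (Suc t) i = p t i)"

end

theory Submission
  imports Defs
begin

text \<open>
  Call a player unsatisfied if it does not achieve best response. Induct on the number of satisfied
  players: one may jump to any profile that keeps the satisfied players fixed, so suppose no such
  profile has a strictly smaller set of satisfied players. Freeze the satisfied players of the
  current profile \<open>x\<close>, take an equilibrium \<open>z\<close> of the remaining subgame, and join \<open>z\<close> to \<open>x\<close> by a
  polynomial curve whose interior points are fully mixed for the unsatisfied players. Each of these
  players has two pure strategies of different payoff at \<open>x\<close>; by polynomiality the two payoffs differ
  at all curve points close to \<open>z\<close>, so a fully mixed strategy cannot be a best response there. Hence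
  near \<open>z\<close> the unsatisfied players stay unsatisfied, by minimality the satisfied ones stay satisfied,
  and in the limit they are still satisfied at \<open>z\<close>: a jump from \<open>x\<close> to \<open>z\<close> ends in an equilibrium.
\<close>

subsection \<open>Brouwer's theorem for a cube with arbitrary finite index set\<close>

text \<open>Sequential compactness of a finite power of \<open>A\<close>: each new coordinate
  refines the subsequence found so far. Coordinates outside \<open>K\<close> stay uncontrolled, so
  \<open>l\<close> matters only on \<open>K\<close>.\<close>

lemma convergent_subseq_finite_coordinates:
  fixes X :: "nat \<Rightarrow> 'k \<Rightarrow> 'a::metric_space"
  assumes "finite K" "compact A" "\<And>n k. k \<in> K \<Longrightarrow> X n k \<in> A"
  shows "\<exists>l r. strict_mono (r :: nat \<Rightarrow> nat) \<and> (\<forall>k\<in>K. l k \<in> A \<and> (\<lambda>n. X (r n) k) \<longlonglongrightarrow> l k)"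
  using assms(1,3)
proof (induction K)
  case empty
  show ?case by (auto intro: strict_mono_id[unfolded id_def])
next
  case (insert j K)
  then obtain l r where r: "strict_mono (r :: nat \<Rightarrow> nat)"
    and l: "\<forall>k\<in>K. l k \<in> A \<and> (\<lambda>n. X (r n) k) \<longlonglongrightarrow> l k"
    by (metis insertI2)
  have "\<forall>n. X (r n) j \<in> A" using insert.prems by simp
  then obtain l' r' where r': "strict_mono (r' :: nat \<Rightarrow> nat)" and l': "l' \<in> A"
      "((\<lambda>n. X (r n) j) \<circ> r') \<longlonglongrightarrow> l'"
    using \<open>compact A\<close>[unfolded compact_def, rule_format, of "\<lambda>n. X (r n) j"] by auto
  have "(\<lambda>n. X ((r \<circ> r') n) k) \<longlonglongrightarrow> (l(j := l')) k \<and> (l(j := l')) k \<in> A" if "k \<in> insert j K" for k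
  proof (cases "k = j")
    case True
    then show ?thesis using l' by (simp add: o_def)
  next
    case False
    then show ?thesis
      using that l LIMSEQ_subseq_LIMSEQ[OF _ r', of "\<lambda>n. X (r n) k" "l k"] by (auto simp: o_def)
  qed
  then show ?case using strict_mono_o[OF r r'] by blast
qed

lemma tendsto_fun_componentwise:
  fixes f :: "'b \<Rightarrow> 'k \<Rightarrow> 'a::topological_space"
  assumes "\<And>k. ((\<lambda>n. f n k) \<longlongrightarrow> l k) F"
  shows "(f \<longlongrightarrow> l) F"
proof -
  have "limitin (product_topology (\<lambda>_. euclidean) UNIV) f l F"
    using assms by (auto simp: limitin_componentwise)
  then show ?thesis by (simp add: euclidean_product_topology)
qed

text \<open>
  The library version needs a type of class \<open>euclidean_space\<close>; the number of pure strategies is not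
  the dimension of any type here, so the theorem is derived from Kuhn's lemma again.
\<close>

lemma brouwer_PiE_unit_interval:
  fixes F :: "('k \<Rightarrow> real) \<Rightarrow> 'k \<Rightarrow> real"
  assumes K: "finite K" and "continuous_on (\<Pi>\<^sub>E k\<in>K. {0..1}) F"
    and "F \<in> (\<Pi>\<^sub>E k\<in>K. {0..1}) \<rightarrow> (\<Pi>\<^sub>E k\<in>K. {0..1})"
  obtains x where "x \<in> (\<Pi>\<^sub>E k\<in>K. {0..1})" "F x = x"
proof -
  define C where "C = (\<Pi>\<^sub>E k\<in>K. {0..1::real})"
  have cont: "continuous_on C F" and F: "F \<in> C \<rightarrow> C" using assms by (simp_all add: C_def)
  have F01: "0 \<le> F x k" "F x k \<le> 1" if "x \<in> C" "k \<in> K" for x k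
    using F that by (auto simp: C_def PiE_iff Pi_iff)
  define n where "n = card K"
  \<comment> \<open>Kuhn's lemma numbers the coordinates by naturals below \<open>n\<close>;
    \<open>e\<close> and its inverse \<open>h\<close> carry it over to \<open>K\<close>.\<close>
  obtain e where e: "bij_betw e {..<n} K"
    using ex_bij_betw_nat_finite[OF K] by (auto simp: n_def atLeast0LessThan)
  define h where "h = the_inv_into {..<n} e"
  have h: "h k < n" "e (h k) = k" if "k \<in> K" for k
    using that e bij_betwE[OF bij_betw_the_inv_into[OF e]]
    by (auto simp: h_def f_the_inv_into_f_bij_betw)
  \<comment> \<open>At mesh 1/(m+1) there is a point \<open>z\<close> such that, for every
    coordinate \<open>k\<close>, \<open>F\<close> does not lower \<open>k\<close> at some nearby
    \<open>u\<close> and does not raise it at some nearby \<open>w\<close>. As the mesh shrinks,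
    \<open>u\<close> and \<open>w\<close> collapse to one limit, which is then fixed in coordinate
    \<open>k\<close>.\<close>
  have grid: "\<exists>z\<in>C. \<forall>k\<in>K. \<exists>u\<in>C. \<exists>w\<in>C.
      (\<forall>j\<in>K. \<bar>u j - z j\<bar> \<le> 1 / Suc m \<and> \<bar>w j - z j\<bar> \<le> 1 / Suc m) \<and> u k \<le> F u k \<and> F w k \<le> w k" for m
  proof -
    define p where "p = Suc m"
    define P where "P v = (\<lambda>k\<in>K. real (v (h k)) / real p)" for v :: "nat \<Rightarrow> nat"
    have PC: "P v \<in> C" if "\<forall>i<n. v i \<le> p" for v
    proof -
      have "real (v (h k)) \<le> real p" if "k \<in> K" for k
        using \<open>\<forall>i<n. v i \<le> p\<close> h(1)[OF that] by simp
      then show ?thesis by (auto simp: C_def P_def p_def divide_le_eq_1)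
    qed
    \<comment> \<open>Label 0 is meant to say that \<open>F\<close> does not lower the coordinate,
      label 1 that \<open>F\<close> does not raise it. Kuhn's lemma prescribes 0 on the lower face
      and 1 on the upper face; this agrees with the meaning because \<open>F\<close> maps the cube
      into itself.\<close>
    define label where "label v i =
      (if v i = 0 \<or> (v i < p \<and> P v (e i) \<le> F (P v) (e i)) then 0 else 1 :: nat)" for v i
    have label01: "label v i = 0 \<or> label v i = 1" for v i by (simp add: label_def)
    have "0 < p" by (simp add: p_def)
    then obtain q where q: "\<forall>i<n. q i < p"
      and rs: "\<forall>i<n. \<exists>r s. (\<forall>j<n. q j \<le> r j \<and> r j \<le> q j + 1) \<and>
                (\<forall>j<n. q j \<le> s j \<and> s j \<le> q j + 1) \<and> label r i \<noteq> label s i"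
      by (rule kuhn_lemma[of p n label]) (use \<open>0 < p\<close> in \<open>auto simp: label_def\<close>)
    have below: "P v k \<le> F (P v) k" if "\<forall>i<n. v i \<le> p" "k \<in> K" "label v (h k) = 0" for v k
      using that h[OF \<open>k \<in> K\<close>] F01(1)[OF PC[OF that(1)] \<open>k \<in> K\<close>]
      by (auto simp: label_def P_def split: if_splits)
    have above: "F (P v) k \<le> P v k" if "\<forall>i<n. v i \<le> p" "k \<in> K" "label v (h k) \<noteq> 0" for v k
    proof (cases "v (h k) = p")
      case True
      then show ?thesis using F01(2)[OF PC[OF that(1)] \<open>k \<in> K\<close>] \<open>k \<in> K\<close> \<open>0 < p\<close> by (simp add: P_def)
    next
      case False
      then show ?thesis
        using that h[OF \<open>k \<in> K\<close>] by (auto simp: label_def le_less split: if_splits)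
    qed
    have near: "\<bar>P v j - P q j\<bar> \<le> 1 / Suc m" if "\<forall>j<n. q j \<le> v j \<and> v j \<le> q j + 1" "j \<in> K" for v j
    proof -
      have "q (h j) \<le> v (h j)" "v (h j) \<le> q (h j) + 1" using that h(1)[OF \<open>j \<in> K\<close>] by auto
      then have "\<bar>real (v (h j)) - real (q (h j))\<bar> \<le> 1" by linarith
      moreover have "P v j - P q j = (real (v (h j)) - real (q (h j))) / p"
        using \<open>j \<in> K\<close> by (simp add: P_def diff_divide_distrib)
      ultimately show ?thesis by (simp add: p_def divide_right_mono del: of_nat_Suc)
    qed
    have le_p: "\<forall>i<n. v i \<le> p" if "\<forall>j<n. q j \<le> v j \<and> v j \<le> q j + 1" for v
      using that q by (metis Suc_eq_plus1 Suc_leI le_trans)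
    show ?thesis
    proof (rule bexI[of _ "P q"], rule ballI)
      fix k assume "k \<in> K"
      then obtain r s where r: "\<forall>j<n. q j \<le> r j \<and> r j \<le> q j + 1"
        and s: "\<forall>j<n. q j \<le> s j \<and> s j \<le> q j + 1" and "label r (h k) \<noteq> label s (h k)"
        using rs h(1) by blast
      then consider "label r (h k) = 0" "label s (h k) \<noteq> 0" | "label s (h k) = 0" "label r (h k) \<noteq> 0"
        using label01 by metis
      then obtain v v' where "label v (h k) = 0" "label v' (h k) \<noteq> 0"
        and v: "\<forall>j<n. q j \<le> v j \<and> v j \<le> q j + 1" and v': "\<forall>j<n. q j \<le> v' j \<and> v' j \<le> q j + 1"
        using r s by cases auto
      then have "P v k \<le> F (P v) k" "F (P v') k \<le> P v' k"
        using below above le_p[OF v] le_p[OF v'] \<open>k \<in> K\<close> by blast+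
      then show "\<exists>u\<in>C. \<exists>w\<in>C.
          (\<forall>j\<in>K. \<bar>u j - P q j\<bar> \<le> 1 / Suc m \<and> \<bar>w j - P q j\<bar> \<le> 1 / Suc m) \<and> u k \<le> F u k \<and> F w k \<le> w k"
        using near[OF v] near[OF v'] PC[OF le_p[OF v]] PC[OF le_p[OF v']]
        by - (rule bexI[of _ "P v"], rule bexI[of _ "P v'"], simp_all)
    next
      show "P q \<in> C" using q by (intro PC) auto
    qed
  qed
  obtain z where z: "\<And>m. z m \<in> C" and "\<And>m. \<forall>k\<in>K. \<exists>u\<in>C. \<exists>w\<in>C.
      (\<forall>j\<in>K. \<bar>u j - z m j\<bar> \<le> 1 / Suc m \<and> \<bar>w j - z m j\<bar> \<le> 1 / Suc m) \<and> u k \<le> F u k \<and> F w k \<le> w k"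
    using grid by metis
  then obtain u w where uw: "\<And>m k. k \<in> K \<Longrightarrow> u m k \<in> C \<and> w m k \<in> C \<and>
      (\<forall>j\<in>K. \<bar>u m k j - z m j\<bar> \<le> 1 / Suc m \<and> \<bar>w m k j - z m j\<bar> \<le> 1 / Suc m) \<and>
      u m k k \<le> F (u m k) k \<and> F (w m k) k \<le> w m k k"
    by metis
  obtain l r where r: "strict_mono (r :: nat \<Rightarrow> nat)"
    and l: "\<forall>k\<in>K. l k \<in> {0..1} \<and> (\<lambda>m. z (r m) k) \<longlonglongrightarrow> l k"
    using convergent_subseq_finite_coordinates[OF K, of "{0..1}" z] z
    by (auto simp: C_def PiE_iff)
  define x where "x = restrict l K"
  have x: "x \<in> C" using l by (auto simp: x_def C_def)
  have lim0: "(\<lambda>m. 1 / Suc (r m)) \<longlonglongrightarrow> 0"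
    using LIMSEQ_subseq_LIMSEQ[OF LIMSEQ_inverse_real_of_nat r]
    by (simp add: o_def inverse_eq_divide)
  \<comment> \<open>Applied below to both \<open>u\<close> and \<open>w\<close>. Convergence in the
    function type concerns all coordinates; outside \<open>K\<close> extensionality makes both sides
    \<open>undefined\<close>.\<close>
  have lim: "v \<longlonglongrightarrow> x" "\<And>k. (\<lambda>m. v m k) \<longlonglongrightarrow> x k" "\<And>k. (\<lambda>m. F (v m) k) \<longlonglongrightarrow> F x k"
    if v: "\<And>m. v m \<in> C" and near: "\<And>m j. j \<in> K \<Longrightarrow> \<bar>v m j - z (r m) j\<bar> \<le> 1 / Suc (r m)" for v
  proof -
    show k: "(\<lambda>m. v m k) \<longlonglongrightarrow> x k" for k
    proof (cases "k \<in> K")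
      case True
      have "(\<lambda>m. v m k - z (r m) k) \<longlonglongrightarrow> 0"
        using near[OF True] by (intro Lim_null_comparison[OF _ lim0]) simp
      then have "(\<lambda>m. (v m k - z (r m) k) + z (r m) k) \<longlonglongrightarrow> 0 + l k"
        using l True by (intro tendsto_add) auto
      then show ?thesis using True by (simp add: x_def)
    next
      case False
      then have "v m k = x k" for m using v[of m] by (simp add: C_def x_def PiE_iff extensional_def)
      then show ?thesis by simp
    qed
    then show v_x: "v \<longlonglongrightarrow> x" by (rule tendsto_fun_componentwise)
    show "(\<lambda>m. F (v m) k) \<longlonglongrightarrow> F x k" for k
      using continuous_on_product_then_coordinatewise[OF cont, of k] v_x x v
      by (intro continuous_on_tendsto_compose[of "C" "\<lambda>y. F y k"]) auto
  qed
  have "F x k = x k" if "k \<in> K" for k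
  proof (rule antisym)
    have "w (r m) k \<in> C" "j \<in> K \<Longrightarrow> \<bar>w (r m) k j - z (r m) j\<bar> \<le> 1 / Suc (r m)" for m j
      using uw[OF that] by blast+
    from LIMSEQ_le[OF lim(3)[OF this] lim(2)[OF this]] show "F x k \<le> x k"
      using uw[OF that] by blast
    have "u (r m) k \<in> C" "j \<in> K \<Longrightarrow> \<bar>u (r m) k j - z (r m) j\<bar> \<le> 1 / Suc (r m)" for m j
      using uw[OF that] by blast+
    from LIMSEQ_le[OF lim(2)[OF this] lim(3)[OF this]] show "x k \<le> F x k"
      using uw[OF that] by blast
  qed
  moreover have "F x \<in> C" using F x by auto
  ultimately have "F x = x" using x by (auto simp: C_def intro: PiE_ext)
  with x show thesis unfolding C_def by (rule that)
qed

subsection \<open>Finite games\<close>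

text \<open>A nonzero polynomial has finitely many roots, so they do not accumulate at
  \<open>b\<close>. The points \<open>a\<close> and \<open>b\<close> are unrelated: one nonzero
  value far away controls the behaviour near \<open>b\<close>.\<close>

lemma real_polynomial_function_eventually_nonzero:
  fixes f :: "real \<Rightarrow> real"
  assumes "real_polynomial_function f" "f a \<noteq> 0"
  shows "\<forall>\<^sub>F t in at b. f t \<noteq> 0"
proof -
  obtain c n where f: "f = (\<lambda>t. \<Sum>i\<le>n. c i * t ^ i)"
    using real_polynomial_function_imp_sum[OF assms(1)] by blast
  have "\<exists>k\<le>n. c k \<noteq> 0"
  proof (rule ccontr)
    assume "\<not> ?thesis"
    then have "f a = 0" by (simp add: f)
    with assms(2) show False by contradiction
  qed
  then have "finite {t. f t = 0}" unfolding f by (subst polyfun_finite_roots) blast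
  then have "\<not> b islimpt {t. f t = 0}" by (simp add: islimpt_finite)
  then show ?thesis by (simp add: islimpt_iff_eventually)
qed

lemma pmf_of_weights:
  fixes f :: "'s \<Rightarrow> real"
  assumes "finite A" "\<And>a. a \<in> A \<Longrightarrow> 0 \<le> f a" "sum f A = 1"
  shows "\<exists>p \<in> mixed_strategies A. \<forall>a\<in>A. pmf p a = f a"
proof -
  \<comment> \<open>\<open>embed_pmf\<close> expects weights on the whole type, while
    \<open>f\<close> is arbitrary outside \<open>A\<close>.\<close>
  define f' where "f' a = (if a \<in> A then f a else 0)" for a
  have nonneg: "0 \<le> f' a" for a using assms(2) by (simp add: f'_def)
  have "(\<integral>\<^sup>+a. ennreal (f' a) \<partial>count_space UNIV) = (\<Sum>a\<in>A. ennreal (f' a))"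
    using assms(1) by (intro nn_integral_count_space') (auto simp: f'_def)
  also have "\<dots> = 1"
    using assms by (subst sum_ennreal) (auto simp: f'_def cong: sum.cong)
  finally have one: "(\<integral>\<^sup>+a. ennreal (f' a) \<partial>count_space UNIV) = 1" .
  have "set_pmf (embed_pmf f') \<subseteq> A"
    by (subst set_embed_pmf[OF nonneg one]) (auto simp: f'_def)
  moreover have "\<forall>a\<in>A. pmf (embed_pmf f') a = f a"
    by (simp add: pmf_embed_pmf[OF nonneg one] f'_def)
  ultimately show ?thesis unfolding mixed_strategies_def by blast
qed

section \<open>Payoffs and best replies in terms of real weights\<close>

locale finite_game =
  fixes I :: "'i set" and S :: "'i \<Rightarrow> 's set" and g :: "'i \<Rightarrow> ('i \<Rightarrow> 's) \<Rightarrow> real"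
  assumes finite_players: "finite I" and finite_strategies: "i \<in> I \<Longrightarrow> finite (S i)"
begin

text \<open>Real weights replace pmfs so that the payoff is a multilinear polynomial in arbitrary
  real vectors. Continuity on a cube and polynomiality along a curve can then be stated without
  asking that every point be a distribution.\<close>

definition payoff :: "'i \<Rightarrow> ('i \<Rightarrow> 's \<Rightarrow> real) \<Rightarrow> real" where
  "payoff i y = (\<Sum>s\<in>PiE I S. g i s * (\<Prod>j\<in>I. y j (s j)))"

definition pure_payoff :: "'i \<Rightarrow> 's \<Rightarrow> ('i \<Rightarrow> 's \<Rightarrow> real) \<Rightarrow> real" where
  "pure_payoff i a y = payoff i (y(i := indicator {a}))"

text \<open>Finitely many inequalities against pure deviations stand in for the supremum over mixed
  ones; \<open>achieves_best_response_iff\<close> shows the agreement on joint mixed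
  strategies.\<close>

definition best_reply :: "'i \<Rightarrow> ('i \<Rightarrow> 's \<Rightarrow> real) \<Rightarrow> bool" where
  "best_reply i y \<longleftrightarrow> (\<forall>a\<in>S i. pure_payoff i a y \<le> payoff i y)"

abbreviation weights :: "('i \<Rightarrow> 's pmf) \<Rightarrow> 'i \<Rightarrow> 's \<Rightarrow> real" where
  "weights \<sigma> \<equiv> \<lambda>i. pmf (\<sigma> i)"

lemma finite_profiles: "finite (PiE I S)"
  using finite_players finite_strategies by (intro finite_PiE)

lemma payoff_cong:
  assumes "\<And>j a. j \<in> I \<Longrightarrow> a \<in> S j \<Longrightarrow> y j a = y' j a"
  shows "payoff i y = payoff i y'"
  unfolding payoff_def using assms by (intro sum.cong prod.cong arg_cong2[where f="(*)"]) (auto simp: PiE_iff)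

lemma pure_payoff_cong:
  assumes "\<And>j a. j \<in> I \<Longrightarrow> a \<in> S j \<Longrightarrow> y j a = y' j a"
  shows "pure_payoff i b y = pure_payoff i b y'"
  unfolding pure_payoff_def using assms by (intro payoff_cong) simp

lemma best_reply_cong:
  assumes "\<And>j a. j \<in> I \<Longrightarrow> a \<in> S j \<Longrightarrow> y j a = y' j a"
  shows "best_reply i y \<longleftrightarrow> best_reply i y'"
  using payoff_cong[OF assms] pure_payoff_cong[OF assms] by (simp add: best_reply_def)

text \<open>Linearity in the weights of player \<open>i\<close>, with \<open>v\<close> expanded into
  point masses.\<close>

lemma payoff_update:
  assumes "i \<in> I"
  shows "payoff i (y(i := v)) = (\<Sum>a\<in>S i. v a * pure_payoff i a y)"
proof -
  define r where "r s = g i s * (\<Prod>j\<in>I - {i}. y j (s j))" for s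
  have upd: "payoff i (y(i := v')) = (\<Sum>s\<in>PiE I S. r s * v' (s i))" for v'
    unfolding payoff_def r_def
  proof (intro sum.cong refl)
    fix s
    have "(\<Prod>j\<in>I. (y(i := v')) j (s j)) = v' (s i) * (\<Prod>j\<in>I - {i}. y j (s j))"
      using finite_players assms by (subst prod.remove[of _ i]) (auto intro!: prod.cong)
    then show "g i s * (\<Prod>j\<in>I. (y(i := v')) j (s j)) = g i s * (\<Prod>j\<in>I - {i}. y j (s j)) * v' (s i)"
      by simp
  qed
  have "(\<Sum>a\<in>S i. v a * pure_payoff i a y)
      = (\<Sum>s\<in>PiE I S. \<Sum>a\<in>S i. v a * (r s * indicator {a} (s i)))"
    unfolding pure_payoff_def upd sum_distrib_left by (rule sum.swap)
  also have "\<dots> = (\<Sum>s\<in>PiE I S. r s * v (s i))"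
  proof (intro sum.cong refl)
    fix s assume "s \<in> PiE I S"
    then have "s i \<in> S i" using assms by auto
    then have "(\<Sum>a\<in>S i. v a * (r s * indicator {a} (s i))) = v (s i) * (r s * indicator {s i} (s i))"
      using finite_strategies[OF assms]
      by (subst sum.remove[of _ "s i"]) (auto simp: indicator_def intro!: sum.neutral)
    then show "(\<Sum>a\<in>S i. v a * (r s * indicator {a} (s i))) = r s * v (s i)" by simp
  qed
  finally show ?thesis by (simp add: upd)
qed

lemma payoff_eq_sum_pure:
  assumes "i \<in> I"
  shows "payoff i y = (\<Sum>a\<in>S i. y i a * pure_payoff i a y)"
  using payoff_update[OF assms, of y "y i"] by simp

lemma joint_mixed_strategiesD:
  assumes "\<sigma> \<in> joint_mixed_strategies I S" "i \<in> I"
  shows "set_pmf (\<sigma> i) \<subseteq> S i" "sum (pmf (\<sigma> i)) (S i) = 1" "S i \<noteq> {}"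
proof -
  show sub: "set_pmf (\<sigma> i) \<subseteq> S i"
    using assms by (auto simp: joint_mixed_strategies_def mixed_strategies_def)
  then show "sum (pmf (\<sigma> i)) (S i) = 1" by (intro sum_pmf_eq_1 finite_strategies assms)
  show "S i \<noteq> {}" using sub set_pmf_not_empty by fastforce
qed

text \<open>The payoff of a mixed deviation is an average of pure payoffs, so it cannot exceed a
  bound that holds for all pure deviations; conversely, pure deviations are mixed ones.\<close>

lemma achieves_best_response_iff:
  assumes "\<sigma> \<in> joint_mixed_strategies I S" "i \<in> I"
  shows "achieves_best_response I S g i \<sigma> \<longleftrightarrow> best_reply i (weights \<sigma>)"
proof -
  have fin: "finite (S i)" using assms by (simp add: finite_strategies)
  let ?d = "\<lambda>a. pure_payoff i a (weights \<sigma>)"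
  have dev: "expected_payoff I S g i (\<sigma>(i := \<tau>)) = (\<Sum>a\<in>S i. pmf \<tau> a * ?d a)" for \<tau>
  proof -
    have "expected_payoff I S g i (\<sigma>(i := \<tau>)) = payoff i ((weights \<sigma>)(i := pmf \<tau>))"
      unfolding expected_payoff_def payoff_def
      by (intro sum.cong prod.cong arg_cong2[where f="(*)"]) auto
    then show ?thesis by (simp add: payoff_update assms)
  qed
  have pure: "expected_payoff I S g i (\<sigma>(i := return_pmf a)) = ?d a" if "a \<in> S i" for a
    using fin that unfolding dev
    by (subst sum.remove[of _ a]) (auto simp: indicator_def intro!: sum.neutral)
  have self: "expected_payoff I S g i \<sigma> = payoff i (weights \<sigma>)"
    by (simp add: expected_payoff_def payoff_def)
  \<comment> \<open>A crude bound, needed because the real-valued supremum is meaningful only for a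
    set bounded above.\<close>
  have "expected_payoff I S g i (\<sigma>(i := \<tau>)) \<le> (\<Sum>a\<in>S i. \<bar>?d a\<bar>)" for \<tau>
    unfolding dev
  proof (intro sum_mono)
    fix a
    have "pmf \<tau> a * ?d a \<le> pmf \<tau> a * \<bar>?d a\<bar>" by (intro mult_left_mono) auto
    also have "\<dots> \<le> 1 * \<bar>?d a\<bar>" by (intro mult_right_mono pmf_le_1) auto
    finally show "pmf \<tau> a * ?d a \<le> \<bar>?d a\<bar>" by simp
  qed
  then have bdd: "bdd_above ((\<lambda>\<tau>. expected_payoff I S g i (\<sigma>(i := \<tau>))) ` mixed_strategies (S i))"
    by (intro bdd_aboveI2)
  have "\<sigma> i \<in> mixed_strategies (S i)" using assms by (auto simp: joint_mixed_strategies_def)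
  then have "achieves_best_response I S g i \<sigma> \<longleftrightarrow>
      (\<forall>\<tau>\<in>mixed_strategies (S i). expected_payoff I S g i (\<sigma>(i := \<tau>)) \<le> payoff i (weights \<sigma>))"
    unfolding achieves_best_response_def self by (intro cSUP_le_iff[OF _ bdd]) auto
  also have "\<dots> \<longleftrightarrow> best_reply i (weights \<sigma>)"
  proof
    assume *: "\<forall>\<tau>\<in>mixed_strategies (S i). expected_payoff I S g i (\<sigma>(i := \<tau>)) \<le> payoff i (weights \<sigma>)"
    have "return_pmf a \<in> mixed_strategies (S i)" if "a \<in> S i" for a
      using that by (simp add: mixed_strategies_def)
    with * show "best_reply i (weights \<sigma>)" unfolding best_reply_def using pure by fastforce
  next
    assume best: "best_reply i (weights \<sigma>)"
    show "\<forall>\<tau>\<in>mixed_strategies (S i). expected_payoff I S g i (\<sigma>(i := \<tau>)) \<le> payoff i (weights \<sigma>)"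
    proof
      fix \<tau> assume "\<tau> \<in> mixed_strategies (S i)"
      then have one: "sum (pmf \<tau>) (S i) = 1"
        by (intro sum_pmf_eq_1 fin) (simp add: mixed_strategies_def)
      have "expected_payoff I S g i (\<sigma>(i := \<tau>)) \<le> (\<Sum>a\<in>S i. pmf \<tau> a * payoff i (weights \<sigma>))"
        unfolding dev using best by (intro sum_mono mult_left_mono) (auto simp: best_reply_def)
      also have "\<dots> = payoff i (weights \<sigma>)" by (simp add: one flip: sum_distrib_right)
      finally show "expected_payoff I S g i (\<sigma>(i := \<tau>)) \<le> payoff i (weights \<sigma>)" .
    qed
  qed
  finally show ?thesis .
qed

text \<open>The payoff is the average of the pure payoffs, none of which exceeds it; with every
  weight positive, no term leaves slack.\<close>

lemma pure_payoff_eq_if_best_reply: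
  assumes "i \<in> I" "best_reply i y" "a \<in> S i"
    and pos: "\<And>a. a \<in> S i \<Longrightarrow> 0 < y i a" and one: "sum (y i) (S i) = 1"
  shows "pure_payoff i a y = payoff i y"
proof -
  have "(\<Sum>a\<in>S i. y i a * (payoff i y - pure_payoff i a y)) = 0"
    using payoff_eq_sum_pure[OF assms(1), of y] one
    by (simp add: right_diff_distrib sum_subtractf flip: sum_distrib_right)
  moreover have "0 \<le> y i b * (payoff i y - pure_payoff i b y)" if "b \<in> S i" for b
    using assms(2) that pos[OF that] by (simp add: best_reply_def)
  ultimately have "y i a * (payoff i y - pure_payoff i a y) = 0"
    using finite_strategies[OF assms(1)] assms(3) by (simp add: sum_nonneg_eq_0_iff)
  then show ?thesis using pos[OF assms(3)] by simp
qed

text \<open>If all pure payoffs agreed, their average would be that common value and no deviation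
  would gain.\<close>

lemma pure_payoff_neq_if_not_best_reply:
  assumes "i \<in> I" "\<not> best_reply i y" and one: "sum (y i) (S i) = 1"
  shows "\<exists>a\<in>S i. \<exists>b\<in>S i. pure_payoff i a y \<noteq> pure_payoff i b y"
proof (rule ccontr)
  assume eq: "\<not> ?thesis"
  obtain b where b: "b \<in> S i" "\<not> pure_payoff i b y \<le> payoff i y"
    using assms(2) by (auto simp: best_reply_def)
  have "payoff i y = (\<Sum>a\<in>S i. y i a * pure_payoff i b y)"
    unfolding payoff_eq_sum_pure[OF assms(1), of y]
  proof (intro sum.cong refl)
    fix a assume "a \<in> S i"
    then have "pure_payoff i a y = pure_payoff i b y" using eq b(1) by blast
    then show "y i a * pure_payoff i a y = y i a * pure_payoff i b y" by simp
  qed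
  also have "\<dots> = pure_payoff i b y" by (simp add: one flip: sum_distrib_right)
  finally show False using b(2) by simp
qed

section \<open>Continuity and polynomiality of payoffs\<close>

lemma continuous_on_payoff:
  assumes "\<And>j a. j \<in> I \<Longrightarrow> a \<in> S j \<Longrightarrow> continuous_on C (\<lambda>x. Y x j a)"
  shows "continuous_on C (\<lambda>x. payoff i (Y x))"
  unfolding payoff_def using assms
  by (intro continuous_intros) (auto simp: PiE_iff)

lemma continuous_on_pure_payoff:
  assumes "\<And>j a. j \<in> I \<Longrightarrow> a \<in> S j \<Longrightarrow> continuous_on C (\<lambda>x. Y x j a)"
  shows "continuous_on C (\<lambda>x. pure_payoff i b (Y x))"
  unfolding pure_payoff_def
proof (rule continuous_on_payoff)
  show "continuous_on C (\<lambda>x. ((Y x)(i := indicator {b})) j a)" if "j \<in> I" "a \<in> S j" for j a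
    using assms that by (cases "j = i") auto
qed

lemma polynomial_payoff:
  assumes "\<And>j a. j \<in> I \<Longrightarrow> a \<in> S j \<Longrightarrow> real_polynomial_function (\<lambda>t. Y t j a)"
  shows "real_polynomial_function (\<lambda>t. payoff i (Y t))"
  unfolding payoff_def using assms finite_players finite_profiles
  by (intro real_polynomial_function_sum real_polynomial_function.intros(2,4)
      real_polynomial_function_prod) (auto simp: PiE_iff)

lemma polynomial_pure_payoff:
  assumes "\<And>j a. j \<in> I \<Longrightarrow> a \<in> S j \<Longrightarrow> real_polynomial_function (\<lambda>t. Y t j a)"
  shows "real_polynomial_function (\<lambda>t. pure_payoff i b (Y t))"
  unfolding pure_payoff_def
proof (rule polynomial_payoff)
  show "real_polynomial_function (\<lambda>t. ((Y t)(i := indicator {b})) j a)" if "j \<in> I" "a \<in> S j" for j a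
    using assms that by (cases "j = i") auto
qed

section \<open>Nash equilibria with some players frozen\<close>

text \<open>Nash's argument, in which the weights of players outside \<open>U\<close> are mere
  parameters of the payoffs: at a fixed point of the improvement map no player in \<open>U\<close>
  has a profitable pure deviation.\<close>

lemma equilibrium_of_subgame:
  assumes U: "U \<subseteq> I" and ne: "\<And>i. i \<in> U \<Longrightarrow> S i \<noteq> {}"
  obtains z where "\<And>i. i \<notin> U \<Longrightarrow> z i = y i"
    and "\<And>i a. i \<in> U \<Longrightarrow> a \<in> S i \<Longrightarrow> 0 \<le> z i a" and "\<And>i. i \<in> U \<Longrightarrow> sum (z i) (S i) = 1"
    and "\<And>i. i \<in> U \<Longrightarrow> best_reply i z"
proof -
  define K where "K = Sigma U S"
  define X where "X = (\<Pi>\<^sub>E k\<in>K. {0..1::real})"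
  define c where "c x i = max 0 (1 - (\<Sum>a\<in>S i. x (i, a)))" for x :: "'i \<times> 's \<Rightarrow> real" and i
  define D where "D x i = (\<Sum>a\<in>S i. x (i, a) + c x i)" for x i
  define \<rho> where "\<rho> x i a = (x (i, a) + c x i) / D x i" for x i a
  define Y where "Y x = (\<lambda>i. if i \<in> U then \<rho> x i else y i)" for x
  define m where "m x i a = max 0 (pure_payoff i a (Y x) - payoff i (Y x))" for x i a
  \<comment> \<open>\<open>\<rho>\<close> retracts the cube onto the product of simplices; \<open>c\<close> keeps its denominator \<open>D\<close> at least 1.
    \<open>F\<close> is Nash's map composed with \<open>\<rho>\<close>.\<close>
  define M where "M x i = (\<Sum>a\<in>S i. m x i a)" for x i
  define F where "F x = (\<lambda>k\<in>K. (\<rho> x (fst k) (snd k) + m x (fst k) (snd k)) / (1 + M x (fst k)))" for x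
  have fin: "finite (S i)" if "i \<in> U" for i using that U finite_strategies by auto
  have "finite U" using U finite_players by (rule finite_subset)
  then have "finite K" unfolding K_def using fin by auto
  have c0: "0 \<le> c x i" for x i by (simp add: c_def)
  have m0: "0 \<le> m x i a" for x i a by (simp add: m_def)
  have M0: "0 \<le> M x i" for x i by (simp add: M_def m0 sum_nonneg)
  have D1: "1 \<le> D x i" if "i \<in> U" for x i
  proof -
    have "1 \<le> card (S i)" using fin ne that by (simp add: Suc_le_eq card_gt_0_iff)
    then have "1 * c x i \<le> card (S i) * c x i" using c0 by (intro mult_right_mono) auto
    moreover have "1 - (\<Sum>a\<in>S i. x (i, a)) \<le> c x i" by (simp add: c_def)
    ultimately show ?thesis by (simp add: D_def sum.distrib)
  qed
  have \<rho>0: "0 \<le> \<rho> x i a" if "x \<in> X" "i \<in> U" "a \<in> S i" for x i a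
  proof -
    have "(i, a) \<in> K" using that by (simp add: K_def)
    then have "0 \<le> x (i, a)" using \<open>x \<in> X\<close> by (auto simp: X_def PiE_iff)
    then show ?thesis using c0[of x i] D1[OF \<open>i \<in> U\<close>, of x] by (simp add: \<rho>_def)
  qed
  have \<rho>_sum: "(\<Sum>a\<in>S i. \<rho> x i a) = 1" if "i \<in> U" for x i
    using D1[OF that, of x] by (simp add: \<rho>_def D_def flip: sum_divide_distrib)
  have \<rho>1: "\<rho> x i a \<le> 1" if "x \<in> X" "i \<in> U" "a \<in> S i" for x i a
    using \<rho>_sum[OF that(2), of x] member_le_sum[of a "S i" "\<rho> x i"] \<rho>0 that fin by auto
  have m_le: "m x i a \<le> M x i" if "i \<in> U" "a \<in> S i" for x i a
    unfolding M_def using that fin m0 by (intro member_le_sum) auto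
  have cont_x: "continuous_on X (\<lambda>x. x k)" for k
    by (rule continuous_on_subset[OF continuous_on_product_coordinates subset_UNIV])
  have cont_c: "continuous_on X (\<lambda>x. c x i)" for i
    unfolding c_def by (intro continuous_intros cont_x)
  have cont_D: "continuous_on X (\<lambda>x. D x i)" for i
    unfolding D_def by (intro continuous_intros cont_x cont_c)
  have cont_\<rho>: "continuous_on X (\<lambda>x. \<rho> x i a)" if "i \<in> U" for i a
    unfolding \<rho>_def using D1[OF that] by (intro continuous_intros cont_x cont_c cont_D) (metis not_one_le_zero)
  have cont_Y: "continuous_on X (\<lambda>x. Y x j a)" for j a
    by (cases "j \<in> U") (simp_all add: Y_def cont_\<rho>)
  have cont_m: "continuous_on X (\<lambda>x. m x i a)" for i a
    unfolding m_def by (intro continuous_intros continuous_on_payoff continuous_on_pure_payoff cont_Y)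
  have cont_M: "continuous_on X (\<lambda>x. M x i)" for i
    unfolding M_def by (intro continuous_intros cont_m)
  have "continuous_on X F"
  proof (rule continuous_on_coordinatewise_then_product)
    fix k
    show "continuous_on X (\<lambda>x. F x k)"
    proof (cases "k \<in> K")
      case True
      then have "fst k \<in> U" by (auto simp: K_def)
      have "1 + M x (fst k) \<noteq> 0" for x using M0[of x "fst k"] by simp
      then have "continuous_on X (\<lambda>x. (\<rho> x (fst k) (snd k) + m x (fst k) (snd k)) / (1 + M x (fst k)))"
        using \<open>fst k \<in> U\<close> by (intro continuous_intros cont_\<rho> cont_m cont_M) auto
      with True show ?thesis by (simp add: F_def)
    qed (simp add: F_def)
  qed
  moreover have "F x \<in> X" if "x \<in> X" for x
  proof -
    have "0 \<le> F x k \<and> F x k \<le> 1" if "k \<in> K" for k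
    proof -
      obtain i a where k: "k = (i, a)" "i \<in> U" "a \<in> S i" using \<open>k \<in> K\<close> unfolding K_def by blast
      show ?thesis
        using \<rho>0[OF \<open>x \<in> X\<close> k(2,3)] \<rho>1[OF \<open>x \<in> X\<close> k(2,3)] m0[of x i a] m_le[OF k(2,3), of x]
          M0[of x i] that by (auto simp: F_def k(1) divide_le_eq_1)
    qed
    then show ?thesis by (auto simp: X_def F_def)
  qed
  ultimately obtain x where x: "x \<in> X" "F x = x"
    using brouwer_PiE_unit_interval[OF \<open>finite K\<close>, of F] unfolding X_def by auto
  have fix_eq: "x (i, a) = (\<rho> x i a + m x i a) / (1 + M x i)" if "i \<in> U" "a \<in> S i" for i a
    using fun_cong[OF x(2), of "(i, a)"] that by (simp add: F_def K_def)
  \<comment> \<open>Summing the fixed point equation over \<open>S i\<close> gives (1 + M) / (1 +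
    M). So the fixed point already lies on the simplices, where \<open>c\<close> vanishes and
    \<open>\<rho>\<close> is the identity.\<close>
  have sum_x: "(\<Sum>a\<in>S i. x (i, a)) = 1" if "i \<in> U" for i
    using \<rho>_sum[OF that, of x] M0[of x i] that
    by (simp add: fix_eq sum.distrib flip: sum_divide_distrib M_def)
  have \<rho>_x: "\<rho> x i a = x (i, a)" if "i \<in> U" for i a
    using sum_x[OF that] by (simp add: \<rho>_def D_def c_def)
  have gain: "x (i, a) * M x i = m x i a" if "i \<in> U" "a \<in> S i" for i a
    using fix_eq[OF that] \<rho>_x[OF that(1), of a] M0[of x i] by (simp add: field_simps)
  \<comment> \<open>The excess payoffs \<open>d\<close> average to 0 under \<open>x\<close>. If
    \<open>M\<close> were nonzero, \<open>gain\<close> would turn each term into \<open>M\<close>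
    times the square of the weight: strategies without gain have weight 0, and on the others
    \<open>d\<close> equals \<open>m\<close>. All weights would then vanish, although they sum to
    1.\<close>
  have M_zero: "M x i = 0" if i: "i \<in> U" for i
  proof (rule ccontr)
    assume M: "M x i \<noteq> 0"
    define d where "d a = pure_payoff i a (Y x) - payoff i (Y x)" for a
    have "(\<Sum>a\<in>S i. x (i, a) * d a) = 0"
      using payoff_eq_sum_pure[of i "Y x"] U i sum_x[OF i]
      by (auto simp: d_def Y_def \<rho>_x right_diff_distrib sum_subtractf simp flip: sum_distrib_right)
    moreover have "x (i, a) * d a = M x i * (x (i, a))\<^sup>2" if "a \<in> S i" for a
    proof (cases "m x i a = 0")
      case True
      then show ?thesis using gain[OF i that] M by simp
    next
      case False
      then have "d a = m x i a" by (auto simp: m_def d_def)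
      then show ?thesis using gain[OF i that] by (simp add: power2_eq_square algebra_simps)
    qed
    ultimately have "M x i * (\<Sum>a\<in>S i. (x (i, a))\<^sup>2) = 0" by (simp add: sum_distrib_left)
    moreover have "(\<Sum>a\<in>S i. (x (i, a))\<^sup>2) \<noteq> 0"
    proof
      assume "(\<Sum>a\<in>S i. (x (i, a))\<^sup>2) = 0"
      then have "\<forall>a\<in>S i. x (i, a) = 0" using fin[OF i] by (simp add: sum_nonneg_eq_0_iff)
      then show False using sum_x[OF i] by simp
    qed
    ultimately show False using M by simp
  qed
  show thesis
  proof (rule that[of "Y x"])
    show "best_reply i (Y x)" if "i \<in> U" for i
    proof -
      have "m x i a \<le> 0" if "a \<in> S i" for a using m_le[OF \<open>i \<in> U\<close> that, of x] M_zero[OF \<open>i \<in> U\<close>] by simp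
      then show ?thesis by (simp add: best_reply_def m_def)
    qed
  qed (use \<rho>0 \<rho>_sum x in \<open>simp_all add: Y_def\<close>)
qed

section \<open>Construction of satisficing paths\<close>

text \<open>Leads from weights back to profiles of pmfs. Outside \<open>U\<close> the old pmf itself
  is reused, because a satisficing path demands equality of strategies for satisfied
  players.\<close>

lemma joint_mixed_strategy_of_weights:
  assumes \<sigma>: "\<sigma> \<in> joint_mixed_strategies I S" and "U \<subseteq> I"
    and w: "\<And>i a. i \<in> U \<Longrightarrow> a \<in> S i \<Longrightarrow> 0 \<le> w i a" "\<And>i. i \<in> U \<Longrightarrow> sum (w i) (S i) = 1"
    and w_eq: "\<And>i. i \<in> I - U \<Longrightarrow> w i = pmf (\<sigma> i)"
  obtains \<tau> where "\<tau> \<in> joint_mixed_strategies I S" "\<And>i. i \<in> I - U \<Longrightarrow> \<tau> i = \<sigma> i"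
    and "\<And>i a. i \<in> I \<Longrightarrow> a \<in> S i \<Longrightarrow> pmf (\<tau> i) a = w i a"
proof -
  have "\<exists>p\<in>mixed_strategies (S i). \<forall>a\<in>S i. pmf p a = w i a" if "i \<in> U" for i
    using that w \<open>U \<subseteq> I\<close> finite_strategies by (intro pmf_of_weights) auto
  then obtain p where p: "\<And>i. i \<in> U \<Longrightarrow> p i \<in> mixed_strategies (S i) \<and> (\<forall>a\<in>S i. pmf (p i) a = w i a)"
    by metis
  define \<tau> where "\<tau> i = (if i \<in> U then p i else \<sigma> i)" for i
  have "\<tau> \<in> joint_mixed_strategies I S"
    using \<sigma> p \<open>U \<subseteq> I\<close> by (auto simp: joint_mixed_strategies_def \<tau>_def PiE_iff extensional_def)
  then show thesis using p w_eq by (intro that[of \<tau>]) (auto simp: \<tau>_def)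
qed

definition satisfied :: "('i \<Rightarrow> 's pmf) \<Rightarrow> 'i set" where
  "satisfied \<sigma> = {i \<in> I. achieves_best_response I S g i \<sigma>}"

lemma satisficing_step:
  assumes \<sigma>: "\<sigma> \<in> joint_mixed_strategies I S"
  shows "\<exists>\<tau>\<in>joint_mixed_strategies I S. (\<forall>i\<in>satisfied \<sigma>. \<tau> i = \<sigma> i) \<and>
    (satisfied \<tau> \<subset> satisfied \<sigma> \<or> satisfied \<tau> = I)"
proof (rule ccontr)
  assume neg: "\<not> ?thesis"
  define U where "U = I - satisfied \<sigma>"
  define y where "y = weights \<sigma>"
  have U: "U \<subseteq> I" "I - U = satisfied \<sigma>" by (auto simp: U_def satisfied_def)
  note strat = joint_mixed_strategiesD[OF \<sigma>]
  have unsat: "\<not> best_reply i y" if "i \<in> U" for i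
    using that achieves_best_response_iff[OF \<sigma>] by (auto simp: U_def satisfied_def y_def)
  have ne: "S i \<noteq> {}" if "i \<in> U" for i using that U(1) strat(3) by blast
  obtain z where z: "\<And>i. i \<notin> U \<Longrightarrow> z i = y i" "\<And>i a. i \<in> U \<Longrightarrow> a \<in> S i \<Longrightarrow> 0 \<le> z i a"
      "\<And>i. i \<in> U \<Longrightarrow> sum (z i) (S i) = 1" "\<And>i. i \<in> U \<Longrightarrow> best_reply i z"
    by (rule equilibrium_of_subgame[OF U(1) ne, of y]) (assumption, rule that)
  \<comment> \<open>A segment from \<open>z\<close> to \<open>y\<close> would not do, as both ends may miss the same pure strategies; the bent
    curve mixes in the uniform strategy with weight \<open>t * (1 - t)\<close>.\<close>
  define Y where "Y t i a = (if i \<in> U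
    then (1 - t) * z i a + t * ((1 - t) / card (S i) + t * y i a) else y i a)" for t i a
  have Y_poly: "real_polynomial_function (\<lambda>t. Y t j a)" for j a
  proof (cases "j \<in> U")
    case True
    have "real_polynomial_function (\<lambda>t::real. t)" by (intro real_polynomial_function.intros(1) bounded_linear_ident)
    with True show ?thesis
      unfolding Y_def by (simp, intro real_polynomial_function.intros(2-4) real_polynomial_function_diff
        real_polynomial_function_divide)
  qed (simp add: Y_def real_polynomial_function.intros(2))
  have Y0: "Y 0 = z" and Y1: "Y 1 = y" using z(1) by (auto simp: Y_def fun_eq_iff)
  have Y_pos: "0 < Y t i a" if "t \<in> {0<..<1}" "i \<in> U" "a \<in> S i" for t i a
  proof -
    have "0 < card (S i)" using that U(1) finite_strategies by (auto simp: card_gt_0_iff)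
    then have "0 < (1 - t) / card (S i) + t * y i a" 
      using that by (intro add_pos_nonneg divide_pos_pos) (auto simp: y_def)
    then show ?thesis using that z(2)[OF that(2,3)] by (auto simp: Y_def intro!: add_nonneg_pos)
  qed
  have Y_sum: "sum (Y t i) (S i) = 1" if "i \<in> U" for t i
  proof -
    have "i \<in> I" using that U(1) by auto
    then have "0 < card (S i)" using finite_strategies strat(3) by (auto simp: card_gt_0_iff)
    then have "sum (Y t i) (S i) = (1 - t) * sum (z i) (S i) + t * ((1 - t) + t * sum (y i) (S i))"
      using that by (simp add: Y_def sum.distrib flip: sum_distrib_left)
    then show ?thesis using z(3)[OF that] strat(2)[OF \<open>i \<in> I\<close>] by (simp add: y_def)
  qed
  have Y_out: "Y t i = pmf (\<sigma> i)" if "i \<in> I - U" for t i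
    using that by (auto simp: Y_def y_def fun_eq_iff)
  have "\<forall>\<^sub>F t in at_right 0. \<not> best_reply i (Y t)" if "i \<in> U" for i
  proof -
    have i: "i \<in> I" using that U(1) by auto
    obtain a b where ab: "a \<in> S i" "b \<in> S i" "pure_payoff i a y \<noteq> pure_payoff i b y"
      using pure_payoff_neq_if_not_best_reply[OF i unsat[OF \<open>i \<in> U\<close>]] strat(2)[OF i] by (auto simp: y_def)
    \<comment> \<open>The difference is a polynomial in \<open>t\<close>, nonzero at
      \<open>t\<close> = 1, where the curve is at \<open>y\<close>. It is therefore nonzero at all
      other points close to \<open>t\<close> = 0, even if the two payoffs tie at \<open>z\<close>
      itself.\<close>
    have "\<forall>\<^sub>F t in at 0. pure_payoff i a (Y t) - pure_payoff i b (Y t) \<noteq> 0"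
      using ab(3) Y1 by (intro real_polynomial_function_eventually_nonzero[where a=1]
        real_polynomial_function_diff polynomial_pure_payoff Y_poly) simp
    then have "\<forall>\<^sub>F t in at_right 0. pure_payoff i a (Y t) - pure_payoff i b (Y t) \<noteq> 0"
      by (rule filter_leD[OF at_le, rotated]) simp
    moreover have "\<forall>\<^sub>F t in at_right 0. t \<in> {0<..<1::real}" by (rule eventually_at_right_real) simp
    ultimately show ?thesis
    proof eventually_elim
      case (elim t)
      show ?case
        using pure_payoff_eq_if_best_reply[of i "Y t"] i Y_pos[OF elim(2) \<open>i \<in> U\<close>]
          Y_sum[OF \<open>i \<in> U\<close>] elim(1) ab(1,2) by fastforce
    qed
  qed
  then have "\<forall>\<^sub>F t in at_right 0. \<forall>i\<in>U. \<not> best_reply i (Y t)"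
    using finite_subset[OF U(1) finite_players] by (simp add: eventually_ball_finite)
  moreover have "\<forall>\<^sub>F t in at_right 0. t \<in> {0<..<1::real}" by (rule eventually_at_right_real) simp
  ultimately have stay: "\<forall>\<^sub>F t in at_right 0. \<forall>i\<in>satisfied \<sigma>. best_reply i (Y t)"
  proof eventually_elim
    case (elim t)
    obtain \<tau> where \<tau>: "\<tau> \<in> joint_mixed_strategies I S" "\<And>i. i \<in> I - U \<Longrightarrow> \<tau> i = \<sigma> i"
      "\<And>i a. i \<in> I \<Longrightarrow> a \<in> S i \<Longrightarrow> pmf (\<tau> i) a = Y t i a"
      by (rule joint_mixed_strategy_of_weights[OF \<sigma> U(1) less_imp_le[OF Y_pos[OF elim(2)]] Y_sum Y_out])
        (assumption+, rule that)
    have best: "i \<in> satisfied \<tau> \<longleftrightarrow> best_reply i (Y t)" if "i \<in> I" for i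
      using achieves_best_response_iff[OF \<tau>(1) that] best_reply_cong[of "weights \<tau>" "Y t" i] \<tau>(3) that
      by (simp add: satisfied_def)
    \<comment> \<open>Players in \<open>U\<close> are unsatisfied at this curve point, which gives
      inclusion. The point is reachable from \<open>\<sigma>\<close> in one jump, so
      \<open>neg\<close> excludes strict inclusion.\<close>
    have "satisfied \<tau> \<subseteq> satisfied \<sigma>" using best elim(1) by (auto simp: U_def satisfied_def)
    with neg \<tau>(1,2) U(2) have "satisfied \<tau> = satisfied \<sigma>" by blast
    then show ?case using best U by auto
  qed
  have "best_reply i z" if i: "i \<in> satisfied \<sigma>" for i
    unfolding best_reply_def
  proof
    fix a assume "a \<in> S i"
    have lim: "(f \<longlongrightarrow> f 0) (at_right 0)" if "real_polynomial_function f" for f :: "real \<Rightarrow> real"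
      using continuous_real_polymonial_function[OF that] by (simp add: continuous_within filterlim_at_split)
    have "pure_payoff i a (Y 0) \<le> payoff i (Y 0)"
    proof (rule tendsto_le[OF trivial_limit_at_right_real])
      show "((\<lambda>t. payoff i (Y t)) \<longlongrightarrow> payoff i (Y 0)) (at_right 0)"
        by (intro lim[of "\<lambda>t. payoff i (Y t)"] polynomial_payoff Y_poly)
      show "((\<lambda>t. pure_payoff i a (Y t)) \<longlongrightarrow> pure_payoff i a (Y 0)) (at_right 0)"
        by (intro lim[of "\<lambda>t. pure_payoff i a (Y t)"] polynomial_pure_payoff Y_poly)
      show "\<forall>\<^sub>F t in at_right 0. pure_payoff i a (Y t) \<le> payoff i (Y t)"
        using stay by eventually_elim (use i \<open>a \<in> S i\<close> in \<open>auto simp: best_reply_def\<close>)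
    qed
    then show "pure_payoff i a z \<le> payoff i z" by (simp add: Y0)
  qed
  \<comment> \<open>Players in \<open>U\<close> are covered by the choice of \<open>z\<close>, the
    others by the limit just taken.\<close>
  then have z_best: "best_reply i z" if "i \<in> I" for i using that z(4) by (cases "i \<in> U") (auto simp: U_def)
  have z_out: "z i = pmf (\<sigma> i)" if "i \<in> I - U" for i using that z(1) by (simp add: y_def)
  obtain \<tau> where \<tau>: "\<tau> \<in> joint_mixed_strategies I S" "\<And>i. i \<in> I - U \<Longrightarrow> \<tau> i = \<sigma> i"
    "\<And>i a. i \<in> I \<Longrightarrow> a \<in> S i \<Longrightarrow> pmf (\<tau> i) a = z i a"
    by (rule joint_mixed_strategy_of_weights[OF \<sigma> U(1) z(2,3) z_out]) (assumption+, rule that)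
  have "achieves_best_response I S g i \<tau>" if "i \<in> I" for i
    using achieves_best_response_iff[OF \<tau>(1) that] best_reply_cong[of "weights \<tau>" z i, OF \<tau>(3)]
      z_best[OF that] by simp
  then have "satisfied \<tau> = I" by (auto simp: satisfied_def)
  with neg \<tau>(1,2) U(2) show False by blast
qed

lemma satisficing_path_to_equilibrium:
  assumes "\<sigma> \<in> joint_mixed_strategies I S"
  shows "\<exists>T p. satisficing_path I S g T p \<and> p 0 = \<sigma> \<and> mixed_equilibrium I S g (p T)"
  using assms
proof (induction "card (satisfied \<sigma>)" arbitrary: \<sigma> rule: less_induct)
  case less
  obtain \<tau> where \<tau>: "\<tau> \<in> joint_mixed_strategies I S" "\<forall>i\<in>satisfied \<sigma>. \<tau> i = \<sigma> i"
    and "satisfied \<tau> \<subset> satisfied \<sigma> \<or> satisfied \<tau> = I"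
    using satisficing_step[OF less.prems] by blast
  then consider "satisfied \<tau> \<subset> satisfied \<sigma>" | "satisfied \<tau> = I" by blast
  then have "\<exists>T p. satisficing_path I S g T p \<and> p 0 = \<tau> \<and> mixed_equilibrium I S g (p T)"
  proof cases
    case 1
    moreover have "finite (satisfied \<sigma>)" using finite_players by (simp add: satisfied_def)
    ultimately show ?thesis using less.hyps \<tau>(1) psubset_card_mono by blast
  next
    case 2
    then show ?thesis using \<tau>(1)
      by (intro exI[of _ 0] exI[of _ "\<lambda>_. \<tau>"])
        (auto simp: satisficing_path_def mixed_equilibrium_def satisfied_def)
  qed
  then obtain T p where p: "satisficing_path I S g T p" "p 0 = \<tau>" "mixed_equilibrium I S g (p T)"
    by blast
  \<comment> \<open>\<open>case_nat \<sigma> p\<close> puts \<open>\<sigma>\<close> in front of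
    \<open>p\<close>; the new first step is legal because \<open>\<tau>\<close> keeps every
    satisfied player's strategy.\<close>
  have "satisficing_path I S g (Suc T) (case_nat \<sigma> p)"
    using p(1,2) less.prems \<tau>(2)
    by (auto simp: satisficing_path_def satisfied_def split: nat.split)
  then show ?case using p(3) by (intro exI[of _ "Suc T"] exI[of _ "case_nat \<sigma> p"]) simp
qed

end

theorem corollary2:
  fixes I :: "'i set" and S :: "'i \<Rightarrow> 's set" and g :: "'i \<Rightarrow> ('i \<Rightarrow> 's) \<Rightarrow> real"
    and \<sigma> :: "'i \<Rightarrow> 's pmf"
  assumes "finite I"
    and "\<And>i. i \<in> I \<Longrightarrow> finite (S i)"
    and "\<sigma> \<in> joint_mixed_strategies I S"
  shows "\<exists>T p. satisficing_path I S g T p \<and> p 0 = \<sigma> \<and> mixed_equilibrium I S g (p T)"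
proof -
  interpret finite_game I S g by (rule finite_game.intro) (fact assms)+
  show ?thesis using assms(3) by (rule satisficing_path_to_equilibrium)
qed

end
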